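(* Let $I$ be a solvable search instance in which all edges have cost one and $h$ is consistent, zero at goals and strictly positive at non-goals. Let $k\ge1$ be an integer and suppose that $h$ is perfect on $B_{\le k}$, i.e. $h(v)=h^*(v)$ for every $v\in B_{\le k}$. Let $H$ be a reachable configuration with minimum $f$-value in OPEN equal to $C^*$, with no goal in $\mathrm{OPEN}_{\min}$, and with $m=m(H)\le k$. Then every low-$h$ continuation $[h,\tau]$ from $H$ (for an arbitrary final tie-breaker $\tau$) performs exactly $m$ further non-goal expansions, and every tie-breaking continuation from the same $H$ performs at least $m$ further non-goal expansions. Both statements hold for every outcome of any random choices.
   Context: **Search instances.** A search instance is $I=(V,A,c,s,\mathcal G,h)$ with $(V,A)$ a finite directed graph, $c:A\to\mathbb R_{\ge0}$ edge costs, $s\notin\mathcal G$ the initial state, $\mathcal G\subseteq V$ the goals, $h:V\to\mathbb R$ a heuristic, together with a fixed order in which successors of each state are generated. $g^*(v)$ is the least cost of a path from $s$ to $v$, $h^*(v)$ the least cost of a path from $v$ to a goal ($+\infty$ if none). The instance is solvable if $C^*:=h^*(s)<\infty$. $h$ is consistent if $h(u)\le c(u,v)+h(v)$ for all $(u,v)\in A$. **A\* model.** Initially OPEN contains only $s$ with $g(s)=0$, and CLOSED is empty. Each OPEN entry stores its best known $g$-value, parent, first-insertion timestamp and goal status. At a selection point let $\mathrm{OPEN}_{\min}$ be the set of $v\in\mathrm{OPEN}$ minimizing $f(v)=g(v)+h(v)$. If $\mathrm{OPEN}_{\min}$ contains a goal, a goal is selected and the search terminates (goal preference; selecting a goal is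 not an expansion). Otherwise the tie-breaker selects a non-goal in $\mathrm{OPEN}_{\min}$, which is expanded: it is moved from OPEN to CLOSED and all its successors are generated in the given order. A newly encountered state is inserted into OPEN; a strictly smaller tentative $g$ updates an existing OPEN entry's $g$ and parent but keeps its first-insertion timestamp; equal- and higher-cost duplicates are discarded. (With consistent $h$ an expanded state has $g=g^*$ and is never reopened.) **Tie-breakers.** A tie-breaker (strategy) is an arbitrary, possibly randomized, history- and instance-dependent rule for choosing the non-goal of $\mathrm{OPEN}_{\min}$ to expand. A low-$h$ strategy $[h,\tau]$ always chooses among the states of $\mathrm{OPEN}_{\min}$ of minimum $h$, using the arbitrary rule $\tau$ for the remaining ties. **Layers.** With $f^*(v)=g^*(v)+h(v)$, $S_=$ is the set of reachable non-goal states with $f^*(v)=C^*$. For integers $j,k\ge1$, $B_j=\{v\in S_=:h(v)=j\}$ and $B_{\le k}=\bigcup_{j=1}^kB_j$. **Configurations.** A search configuration $H$ consists of OPEN, CLOSED, the current $g$-values, parent pointers and insertion timestamps; it is reachable if it occurs at a selection point of some run of the A* model on $I$ (with some tie-breaking choices). At a selection point with minimum $f=C^*$ and no goal in $\mathrm{OPEN}_{\min}$, $m(H)=\min\{h(v):v\in\mathrm{OPEN}_{\min}(H)\}$. Goals with larger $f$ may be in OPEN. A continuation from $H$ is the rest of a run that starts at the configuration $H$ (the whole configuration being fixed) and proceeds until termination. *)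

theory Defs
  imports "Graph_Theory.Graph_Theory" "HOL-Library.Extended_Nat" "HOL-Library.Extended_Real"
begin

section \<open>Search instances\<close>

record 'v search_instance =
  graph :: "'v pair_pre_digraph"
  cost :: "'v \<times> 'v \<Rightarrow> real"
  source :: 'v
  goals :: "'v set"
  heur :: "'v \<Rightarrow> real"
  succs :: "'v \<Rightarrow> 'v list" \<comment> \<open>the successors of a state, in generation order\<close>

definition search_instance :: "'v search_instance \<Rightarrow> bool" where
  "search_instance I \<longleftrightarrow>
     pair_fin_digraph (graph I) \<and>
     (\<forall>a \<in> parcs (graph I). 0 \<le> cost I a) \<and>
     source I \<in> pverts (graph I) \<and>
     goals I \<subseteq> pverts (graph I) \<and>
     source I \<notin> goals I \<and>
     (\<forall>v \<in> pverts (graph I).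
        distinct (succs I v) \<and> set (succs I v) = {w. (v, w) \<in> parcs (graph I)})"

text \<open>\<open>wf_digraph.\<mu>\<close> is the infimum of the costs of all walks between two vertices. In a finite
  digraph with nonnegative costs it is the least cost of a path, and it is \<open>\<infinity>\<close> if there is none.\<close>

definition gstar :: "'v search_instance \<Rightarrow> 'v \<Rightarrow> ereal" where
  "gstar I v = wf_digraph.\<mu> (with_proj (graph I)) (cost I) (source I) v"

definition hstar :: "'v search_instance \<Rightarrow> 'v \<Rightarrow> ereal" where
  "hstar I v = (INF t \<in> goals I. wf_digraph.\<mu> (with_proj (graph I)) (cost I) v t)"

definition Cstar :: "'v search_instance \<Rightarrow> ereal" where
  "Cstar I = hstar I (source I)"

definition solvable :: "'v search_instance \<Rightarrow> bool" where
  "solvable I \<longleftrightarrow> Cstar I < \<infinity>"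

definition consistent :: "'v search_instance \<Rightarrow> bool" where
  "consistent I \<longleftrightarrow> (\<forall>(u, v) \<in> parcs (graph I). heur I u \<le> cost I (u, v) + heur I v)"

definition fstar :: "'v search_instance \<Rightarrow> 'v \<Rightarrow> ereal" where
  "fstar I v = gstar I v + ereal (heur I v)"

definition S_eq :: "'v search_instance \<Rightarrow> 'v set" where
  "S_eq I = {v. source I \<rightarrow>\<^sup>*\<^bsub>with_proj (graph I)\<^esub> v \<and> v \<notin> goals I \<and> fstar I v = Cstar I}"

definition layer :: "'v search_instance \<Rightarrow> nat \<Rightarrow> 'v set" where
  "layer I j = {v \<in> S_eq I. heur I v = real j}"

definition layers_upto :: "'v search_instance \<Rightarrow> nat \<Rightarrow> 'v set" where
  "layers_upto I k = (\<Union>j \<in> {1..k}. layer I j)"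


section \<open>Configurations and the A* model\<close>

record 'v entry =
  gval :: real
  parent :: "'v option"
  stamp :: nat

text \<open>The goal status of an entry is not stored; it is membership of the state in \<open>goals I\<close>.\<close>

record 'v config =
  open_list :: "'v \<rightharpoonup> 'v entry"
  closed_list :: "'v \<rightharpoonup> 'v entry"

definition encountered :: "'v config \<Rightarrow> 'v set" where
  "encountered H = dom (open_list H) \<union> dom (closed_list H)"

definition init_config :: "'v search_instance \<Rightarrow> 'v config" where
  "init_config I =
     \<lparr>open_list = [source I \<mapsto> \<lparr>gval = 0, parent = None, stamp = 0\<rparr>], closed_list = Map.empty\<rparr>"

definition fval :: "'v search_instance \<Rightarrow> 'v config \<Rightarrow> 'v \<Rightarrow> real" where
  "fval I H v = gval (the (open_list H v)) + heur I v"

definition open_min :: "'v search_instance \<Rightarrow> 'v config \<Rightarrow> 'v set" where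
  "open_min I H =
     {v \<in> dom (open_list H). \<forall>w \<in> dom (open_list H). fval I H v \<le> fval I H w}"

text \<open>The minimum \<open>f\<close>-value in OPEN, with value \<open>\<infinity>\<close> if OPEN is empty.\<close>

definition fmin :: "'v search_instance \<Rightarrow> 'v config \<Rightarrow> ereal" where
  "fmin I H = (INF v \<in> dom (open_list H). ereal (fval I H v))"

definition min_h :: "'v search_instance \<Rightarrow> 'v config \<Rightarrow> real" where
  "min_h I H = Min (heur I ` open_min I H)"

definition terminated :: "'v search_instance \<Rightarrow> 'v config \<Rightarrow> bool" where
  "terminated I H \<longleftrightarrow> dom (open_list H) = {} \<or> open_min I H \<inter> goals I \<noteq> {}"

text \<open>Generation of the successor \<open>w\<close> of \<open>v\<close>, where \<open>v\<close> is expanded with cost value \<open>gv\<close>.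
  The timestamp of a new state is the number of states inserted before it. Duplicates of closed
  states are discarded; for consistent heuristics they never improve on the closed state.\<close>

definition generate :: "'v search_instance \<Rightarrow> 'v \<Rightarrow> real \<Rightarrow> 'v \<Rightarrow> 'v config \<Rightarrow> 'v config" where
  "generate I v gv w H =
     (let g' = gv + cost I (v, w) in
      if w \<notin> encountered H then
        H\<lparr>open_list := (open_list H)
            (w \<mapsto> \<lparr>gval = g', parent = Some v, stamp = card (encountered H)\<rparr>)\<rparr>
      else case open_list H w of
        None \<Rightarrow> H
      | Some e \<Rightarrow>
          if g' < gval e
          then H\<lparr>open_list := (open_list H)(w \<mapsto> e\<lparr>gval := g', parent := Some v\<rparr>)\<rparr>
          else H)"

definition expand :: "'v search_instance \<Rightarrow> 'v \<Rightarrow> 'v config \<Rightarrow> 'v config" where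
  "expand I v H =
     (let e = the (open_list H v) in
      fold (generate I v (gval e)) (succs I v)
        \<lparr>open_list = (open_list H)(v := None), closed_list = (closed_list H)(v \<mapsto> e)\<rparr>)"

text \<open>A history lists, oldest first, the configurations at the selection points visited so far.\<close>

inductive history :: "'v search_instance \<Rightarrow> 'v config list \<Rightarrow> bool" for I where
  init: "history I [init_config I]"
| step: "history I hs \<Longrightarrow> \<not> terminated I (last hs) \<Longrightarrow> v \<in> open_min I (last hs) \<Longrightarrow>
    history I (hs @ [expand I v (last hs)])"

definition reachable_config :: "'v search_instance \<Rightarrow> 'v config \<Rightarrow> bool" where
  "reachable_config I H \<longleftrightarrow> (\<exists>hs. history I hs \<and> last hs = H)"


section \<open>Tie-breakers and continuations\<close>

text \<open>A strategy maps the outcome of its random choices and the history to the state to expand.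
  Dependence on the instance is obtained by quantifying over strategies after the instance.\<close>

type_synonym ('r, 'v) strategy = "'r \<Rightarrow> 'v config list \<Rightarrow> 'v"

definition tie_breaker :: "'v search_instance \<Rightarrow> ('r, 'v) strategy \<Rightarrow> bool" where
  "tie_breaker I \<sigma> \<longleftrightarrow>
     (\<forall>\<omega> hs. history I hs \<and> \<not> terminated I (last hs) \<longrightarrow>
        \<sigma> \<omega> hs \<in> open_min I (last hs) - goals I)"

text \<open>The rule \<open>\<tau>\<close> in \<open>[h,\<tau>]\<close> receives, in addition, the set of tied candidates.\<close>

type_synonym ('r, 'v) tie_rule = "'r \<Rightarrow> 'v config list \<Rightarrow> 'v set \<Rightarrow> 'v"

definition tie_rule :: "('r, 'v) tie_rule \<Rightarrow> bool" where
  "tie_rule \<tau> \<longleftrightarrow> (\<forall>\<omega> hs X. X \<noteq> {} \<longrightarrow> \<tau> \<omega> hs X \<in> X)"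

definition low_h :: "'v search_instance \<Rightarrow> ('r, 'v) tie_rule \<Rightarrow> ('r, 'v) strategy" where
  "low_h I \<tau> \<omega> hs = \<tau> \<omega> hs {v \<in> open_min I (last hs). heur I v = min_h I (last hs)}"

text \<open>\<open>continuation I \<sigma> \<omega> hs n\<close> is the history after at most \<open>n\<close> further expansions
  from the configuration \<open>last hs\<close>; it stays constant after termination.\<close>

primrec continuation ::
  "'v search_instance \<Rightarrow> ('r, 'v) strategy \<Rightarrow> 'r \<Rightarrow> 'v config list \<Rightarrow> nat \<Rightarrow> 'v config list" where
  "continuation I \<sigma> \<omega> hs 0 = hs"
| "continuation I \<sigma> \<omega> hs (Suc n) =
     (let hs' = continuation I \<sigma> \<omega> hs n in
      if terminated I (last hs') then hs'
      else hs' @ [expand I (\<sigma> \<omega> hs') (last hs')])"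

definition num_expansions ::
  "'v search_instance \<Rightarrow> ('r, 'v) strategy \<Rightarrow> 'r \<Rightarrow> 'v config list \<Rightarrow> enat" where
  "num_expansions I \<sigma> \<omega> hs =
     (if \<exists>n. terminated I (last (continuation I \<sigma> \<omega> hs n))
      then enat (LEAST n. terminated I (last (continuation I \<sigma> \<omega> hs n)))
      else \<infinity>)"


section \<open>Low-h strategies are tie-breakers\<close>

lemma finite_dom_generate:
  "finite (dom (open_list H)) \<Longrightarrow> finite (dom (open_list (generate I v gv w H)))"
  by (auto simp: generate_def Let_def split: option.split)

lemma finite_dom_fold_generate:
  "finite (dom (open_list H)) \<Longrightarrow> finite (dom (open_list (fold (generate I v gv) ws H)))"
  by (induction ws arbitrary: H) (auto simp: finite_dom_generate)

lemma finite_open_history: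
  "history I hs \<Longrightarrow> finite (dom (open_list (last hs)))"
proof (induction rule: history.induct)
  case init
  then show ?case by (simp add: init_config_def del: fun_upd_apply)
next
  case (step hs v)
  then show ?case by (simp add: expand_def Let_def finite_dom_fold_generate)
qed

lemma tie_breaker_low_h:
  assumes "tie_rule \<tau>"
  shows "tie_breaker I (low_h I \<tau>)"
  unfolding tie_breaker_def
proof (intro allI impI)
  fix \<omega> hs
  assume *: "history I hs \<and> \<not> terminated I (last hs)"
  let ?H = "last hs"
  have fin: "finite (dom (open_list ?H))" and ne: "dom (open_list ?H) \<noteq> {}"
    and ng: "open_min I ?H \<inter> goals I = {}"
    using * by (auto simp: finite_open_history terminated_def)
  obtain v where "v \<in> dom (open_list ?H)" "fval I ?H v = Min (fval I ?H ` dom (open_list ?H))"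
    using Min_in[of "fval I ?H ` dom (open_list ?H)"] fin ne by fastforce
  then have "v \<in> open_min I ?H"
    using fin by (auto simp: open_min_def intro!: Min_le)
  moreover have "finite (open_min I ?H)"
    using fin by (simp add: open_min_def)
  ultimately have "min_h I ?H \<in> heur I ` open_min I ?H"
    unfolding min_h_def by (intro Min_in) auto
  then have "{v \<in> open_min I ?H. heur I v = min_h I ?H} \<noteq> {}" by auto
  from assms[unfolded tie_rule_def, rule_format, OF this]
  have "low_h I \<tau> \<omega> hs \<in> {v \<in> open_min I ?H. heur I v = min_h I ?H}"
    unfolding low_h_def .
  then show "low_h I \<tau> \<omega> hs \<in> open_min I ?H - goals I"
    using ng by auto
qed

end

theory Submission
  imports Defs
begin

text \<open>
  Once the minimum \<open>f\<close>-value in OPEN is \<open>C\<^sup>*\<close>, consistency keeps it there until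
  termination, and an expansion of \<open>v\<close> adds to \<open>OPEN\<^sub>m\<^sub>i\<^sub>n\<close> only
  states with heuristic value \<open>h(v) - 1\<close>. So the least heuristic value on \<open>OPEN\<^sub>m\<^sub>i\<^sub>n\<close>
  drops by at most one per expansion, and it has to reach zero before a goal is selected.

  Conversely, let \<open>v\<close> of minimal \<open>h(v) = j\<close> be expanded, where \<open>h\<close> is perfect. Follow a path of
  length \<open>j\<close> from \<open>v\<close> to a goal. Goals are never closed, so the path leaves CLOSED, and
  its first state outside CLOSED lies in \<open>OPEN\<^sub>m\<^sub>i\<^sub>n\<close> with heuristic value at most \<open>j - 1\<close>.
  This argument does not care which of the states on the path were closed before \<open>v\<close>.
\<close>

section \<open>Walk lengths\<close>

lemma awalk_imp_relpow:
  assumes "pair_wf_digraph G" and "pre_digraph.awalk (with_proj G) u p v"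
  shows "(u, v) \<in> parcs G ^^ length p"
proof -
  interpret pair_wf_digraph G by fact
  show ?thesis
    using assms(2)
    by (induction p arbitrary: u) (auto simp: awalk_simps simp del: relpow.simps(2) intro: relpow_Suc_I2)
qed

lemma relpow_imp_awalk:
  assumes "pair_wf_digraph G" and "u \<in> pverts G" and "(u, v) \<in> parcs G ^^ n"
  shows "\<exists>p. pre_digraph.awalk (with_proj G) u p v \<and> length p = n"
proof -
  interpret pair_wf_digraph G by fact
  show ?thesis
    using assms(2,3)
  proof (induction n arbitrary: u)
    case 0
    then show ?case by (auto simp: awalk_simps)
  next
    case (Suc n)
    then obtain w where w: "(u, w) \<in> parcs G" "(w, v) \<in> parcs G ^^ n"
      by (meson relpow_Suc_D2)
    then have "w \<in> pverts G" by (auto dest: in_arcsD2)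
    with Suc.IH w(2) obtain p where "awalk w p v" "length p = n" by blast
    with w(1) show ?case
      by (intro exI[of _ "(u, w) # p"]) (simp add: awalk_simps)
  qed
qed

text \<open>With unit costs a walk costs its length, so the infimum runs over exponents of the arc
  relation. The start must be a vertex because the empty walk requires it, while the zeroth power is
  the full identity.\<close>

lemma mu_unit_cost:
  assumes "pair_wf_digraph G" and "u \<in> pverts G" and unit: "\<forall>a \<in> parcs G. c a = 1"
  shows "wf_digraph.\<mu> (with_proj G) c u v = (INF n \<in> {n. (u, v) \<in> parcs G ^^ n}. ereal (real n))"
proof -
  interpret pair_wf_digraph G by fact
  have cost: "awalk_cost c p = real (length p)" if "awalk u p v" for p
    using that unit by (induction p arbitrary: u) (auto simp: awalk_simps)
  have len: "{n. (u, v) \<in> parcs G ^^ n} = length ` {p. awalk u p v}"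
    using awalk_imp_relpow[OF assms(1)] relpow_imp_awalk[OF assms(1,2)] by force
  have "\<mu> c u v = (INF p \<in> {p. awalk u p v}. ereal (real (length p)))"
    unfolding \<mu>_def by (intro INF_cong) (auto simp: cost)
  also have "\<dots> = (INF n \<in> {n. (u, v) \<in> parcs G ^^ n}. ereal (real n))"
    unfolding len image_image ..
  finally show ?thesis .
qed

text \<open>Well-ordering turns the infimum into a minimum; finiteness excludes the empty set, whose
  infimum is the top element.\<close>

lemma INF_nat_attained:
  fixes N :: "nat set"
  assumes "(INF n \<in> N. ereal (real n)) < \<infinity>"
  shows "\<exists>n \<in> N. (\<forall>m \<in> N. n \<le> m) \<and> (INF n \<in> N. ereal (real n)) = ereal (real n)"
proof -
  have ne: "N \<noteq> {}" using assms by (auto simp: top_ereal_def)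
  define n where "n = (LEAST n. n \<in> N)"
  have n: "n \<in> N" using ne unfolding n_def by (auto intro: LeastI)
  have least: "n \<le> m" if "m \<in> N" for m using that unfolding n_def by (rule Least_le)
  have "(INF n \<in> N. ereal (real n)) = ereal (real n)"
    using n least by (intro antisym INF_lower INF_greatest) auto
  with n least show ?thesis by blast
qed


section \<open>The effect of an expansion\<close>

lemma closed_list_fold_generate [simp]:
  "closed_list (fold (generate I v gv) ws H) = closed_list H"
proof (induction ws arbitrary: H)
  case (Cons w ws)
  have "closed_list (generate I v gv w H) = closed_list H"
    by (auto simp: generate_def Let_def split: option.split)
  with Cons show ?case by simp
qed simp

text \<open>The last disjunction records that a closed state is not put back into OPEN; it keeps
  OPEN and CLOSED disjoint. Parents and timestamps are left out, as the later bounds concern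
  g-values.\<close>

lemma open_list_fold_generateD:
  assumes "open_list (fold (generate I v gv) ws H) x = Some e"
  shows "(\<exists>e0. open_list H x = Some e0 \<and> gval e0 = gval e) \<or>
    x \<in> set ws \<and> gval e = gv + cost I (v, x) \<and> (x \<in> dom (open_list H) \<or> x \<notin> dom (closed_list H))"
  using assms
proof (induction ws arbitrary: H)
  case (Cons w ws)
  have "closed_list (generate I v gv w H) = closed_list H"
    using closed_list_fold_generate[of I v gv "[w]" H] by simp
  moreover have "(\<exists>e0. open_list H x = Some e0 \<and> gval e0 = gval e1) \<or>
      x = w \<and> gval e1 = gv + cost I (v, x) \<and> (x \<in> dom (open_list H) \<or> x \<notin> dom (closed_list H))"
    if "open_list (generate I v gv w H) x = Some e1" for e1
    using that
    by (auto simp: generate_def Let_def encountered_def split: option.splits if_splits)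
  ultimately show ?case
    using Cons.IH[of "generate I v gv w H"] Cons.prems by fastforce
qed simp

lemma open_list_generate_mono:
  assumes "open_list H x = Some e"
  shows "\<exists>e'. open_list (generate I v gv w H) x = Some e' \<and> gval e' \<le> gval e"
  using assms by (auto simp: generate_def Let_def encountered_def split: option.splits)

lemma open_list_fold_generate_mono:
  assumes "open_list H x = Some e"
  shows "\<exists>e'. open_list (fold (generate I v gv) ws H) x = Some e' \<and> gval e' \<le> gval e"
  using assms
proof (induction ws arbitrary: H e)
  case (Cons w ws)
  then show ?case
    using open_list_generate_mono[OF Cons.prems, of I v gv w] by fastforce
qed auto

text \<open>Generating \<open>x\<close> itself enforces the bound, whether \<open>x\<close> is
  inserted, improved or discarded as a duplicate; later generations only lower the value.\<close>

lemma open_list_fold_generate_succ: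
  assumes "x \<in> set ws" and "x \<notin> dom (closed_list H)"
  shows "\<exists>e. open_list (fold (generate I v gv) ws H) x = Some e \<and> gval e \<le> gv + cost I (v, x)"
  using assms
proof (induction ws arbitrary: H)
  case (Cons w ws)
  show ?case
  proof (cases "x = w")
    case True
    have "\<exists>e. open_list (generate I v gv w H) w = Some e \<and> gval e \<le> gv + cost I (v, w)"
      using Cons.prems(2) True
      by (auto simp: generate_def Let_def encountered_def split: option.splits)
    then obtain e where e: "open_list (generate I v gv w H) w = Some e" "gval e \<le> gv + cost I (v, w)"
      by blast
    show ?thesis
      using open_list_fold_generate_mono[OF e(1), of I v gv ws] e(2) True by fastforce
  next
    case False
    moreover have "closed_list (generate I v gv w H) = closed_list H"
      using closed_list_fold_generate[of I v gv "[w]" H] by simp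
    ultimately show ?thesis
      using Cons by simp
  qed
qed simp

lemma closed_list_expand [simp]:
  "closed_list (expand I v H) = (closed_list H)(v \<mapsto> the (open_list H v))"
  by (simp add: expand_def Let_def)

text \<open>\<open>x \<noteq> v\<close> holds even at a self-loop, since \<open>v\<close> enters
  CLOSED before its successors are generated.\<close>

lemma open_list_expandD:
  assumes "open_list (expand I v H) x = Some e"
  shows "x \<noteq> v \<and>
    ((\<exists>e0. open_list H x = Some e0 \<and> gval e0 = gval e) \<or>
     x \<in> set (succs I v) \<and> gval e = gval (the (open_list H v)) + cost I (v, x) \<and>
     (x \<in> dom (open_list H) \<or> x \<notin> dom (closed_list H)))"
  using open_list_fold_generateD[OF assms[unfolded expand_def Let_def]]
  by (auto split: if_splits)

lemma open_list_expand_mono: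
  assumes "open_list H x = Some e" and "x \<noteq> v"
  shows "\<exists>e'. open_list (expand I v H) x = Some e' \<and> gval e' \<le> gval e"
  unfolding expand_def Let_def
  by (rule open_list_fold_generate_mono) (simp add: assms)

lemma open_list_expand_succ:
  assumes "x \<in> set (succs I v)" and "x \<notin> dom (closed_list H)" and "x \<noteq> v"
  shows "\<exists>e. open_list (expand I v H) x = Some e \<and>
    gval e \<le> gval (the (open_list H v)) + cost I (v, x)"
  unfolding expand_def Let_def
  by (rule open_list_fold_generate_succ) (use assms in auto)


section \<open>Invariants of A* with unit costs and a consistent heuristic\<close>

locale unit_cost_search =
  fixes I :: "'v search_instance"
  assumes instance_wf: "search_instance I"
    and unit_cost: "\<forall>a \<in> parcs (graph I). cost I a = 1"
    and consistent: "consistent I"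
    and heur_goal: "\<forall>v \<in> goals I. heur I v = 0"
    and heur_pos: "\<forall>v \<in> pverts (graph I) - goals I. 0 < heur I v"
begin

section \<open>Walks measured by their length\<close>

abbreviation "arcs_rel \<equiv> parcs (graph I)"

text \<open>Relational powers unroll at either end: the last arc is split off in inductions from the
  source, the first in inductions towards a goal.\<close>

definition walk_len :: "'v \<Rightarrow> nat \<Rightarrow> 'v \<Rightarrow> bool" where
  "walk_len u n v \<longleftrightarrow> (u, v) \<in> arcs_rel ^^ n"

lemma walk_len_0 [simp]: "walk_len u 0 v \<longleftrightarrow> u = v"
  by (auto simp: walk_len_def)

lemma walk_len_Suc: "walk_len u (Suc n) v \<longleftrightarrow> (\<exists>w. walk_len u n w \<and> (w, v) \<in> arcs_rel)"
  by (auto simp: walk_len_def)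

lemma walk_len_Suc2: "walk_len u (Suc n) v \<longleftrightarrow> (\<exists>w. (u, w) \<in> arcs_rel \<and> walk_len w n v)"
  unfolding walk_len_def by (metis relpow_Suc_D2 relpow_Suc_I2)

lemma wf_graph: "pair_wf_digraph (graph I)"
  using instance_wf
  by (auto simp: search_instance_def pair_fin_digraph_def)

lemma arc_verts: "(u, v) \<in> arcs_rel \<Longrightarrow> u \<in> pverts (graph I) \<and> v \<in> pverts (graph I)"
  using pair_wf_digraph.in_arcsD1[OF wf_graph] pair_wf_digraph.in_arcsD2[OF wf_graph] by blast

lemma source_vert: "source I \<in> pverts (graph I)"
  using instance_wf by (simp add: search_instance_def)

lemma set_succs: "v \<in> pverts (graph I) \<Longrightarrow> set (succs I v) = {w. (v, w) \<in> arcs_rel}"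
  using instance_wf by (simp add: search_instance_def)

lemma walk_len_verts: "walk_len (source I) n v \<Longrightarrow> v \<in> pverts (graph I)"
  using source_vert arc_verts by (cases n) (auto simp: walk_len_Suc)

lemma heur_arc: "(u, v) \<in> arcs_rel \<Longrightarrow> heur I u \<le> 1 + heur I v"
  using consistent unit_cost unfolding consistent_def by force

text \<open>Consistency telescopes along the walk, starting from the value 0 at the goal.\<close>

lemma admissible: "walk_len v n t \<Longrightarrow> t \<in> goals I \<Longrightarrow> heur I v \<le> real n"
proof (induction n arbitrary: v)
  case 0
  then show ?case using heur_goal by simp
next
  case (Suc n)
  then obtain w where "(v, w) \<in> arcs_rel" "walk_len w n t" by (auto simp: walk_len_Suc2)
  then show ?case using Suc.IH[of w] Suc.prems(2) heur_arc[of v w] by simp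
qed

lemma gstar_eq: "gstar I v = (INF n \<in> {n. walk_len (source I) n v}. ereal (real n))"
  unfolding gstar_def walk_len_def by (rule mu_unit_cost[OF wf_graph source_vert unit_cost])

definition goal_lens :: "'v \<Rightarrow> nat set" where
  "goal_lens v = {n. \<exists>t \<in> goals I. walk_len v n t}"

lemma hstar_eq:
  assumes "v \<in> pverts (graph I)"
  shows "hstar I v = (INF n \<in> goal_lens v. ereal (real n))"
proof -
  have "hstar I v = (INF t \<in> goals I. INF n \<in> {n. walk_len v n t}. ereal (real n))"
    unfolding hstar_def walk_len_def
    by (simp add: mu_unit_cost[OF wf_graph assms unit_cost])
  also have "\<dots> = (INF n \<in> (\<Union>t \<in> goals I. {n. walk_len v n t}). ereal (real n))"
    by (intro antisym INF_greatest) (auto intro: INF_lower INF_lower2)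
  also have "(\<Union>t \<in> goals I. {n. walk_len v n t}) = goal_lens v"
    by (auto simp: goal_lens_def)
  finally show ?thesis .
qed

text \<open>A Dijkstra-style invariant. On CLOSED, the witnessing walk and the bound over all walks
  together make the g-value optimal. The arc clause makes OPEN a frontier that any walk leaving
  CLOSED meets at relaxed cost; the source clause starts inductions along walks.\<close>

definition astar_inv :: "'v config \<Rightarrow> bool" where
  "astar_inv H \<longleftrightarrow>
     dom (open_list H) \<inter> dom (closed_list H) = {} \<and>
     (\<forall>x e. open_list H x = Some e \<longrightarrow> (\<exists>n. gval e = real n \<and> walk_len (source I) n x)) \<and>
     (\<forall>x e. closed_list H x = Some e \<longrightarrow> x \<notin> goals I \<and>
        (\<exists>n. gval e = real n \<and> walk_len (source I) n x) \<and>
        (\<forall>n. walk_len (source I) n x \<longrightarrow> gval e \<le> real n) \<and>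
        (\<forall>w. (x, w) \<in> arcs_rel \<longrightarrow> w \<in> dom (closed_list H) \<or>
           (\<exists>e'. open_list H w = Some e' \<and> gval e' \<le> gval e + 1))) \<and>
     (source I \<in> dom (closed_list H) \<or> (\<exists>e. open_list H (source I) = Some e \<and> gval e \<le> 0))"

lemma astar_inv_disjoint: "astar_inv H \<Longrightarrow> open_list H x = Some e \<Longrightarrow> x \<notin> dom (closed_list H)"
  unfolding astar_inv_def by auto

lemma astar_inv_open:
  assumes "astar_inv H" "open_list H x = Some e"
  obtains n where "gval e = real n" "walk_len (source I) n x"
  using assms unfolding astar_inv_def by blast

lemma astar_inv_closed_goal: "astar_inv H \<Longrightarrow> closed_list H x = Some e \<Longrightarrow> x \<notin> goals I"
  unfolding astar_inv_def by blast

lemma astar_inv_closed: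
  assumes "astar_inv H" "closed_list H x = Some e"
  obtains n where "gval e = real n" "walk_len (source I) n x"
  using assms unfolding astar_inv_def by blast

lemma astar_inv_closed_le:
  "astar_inv H \<Longrightarrow> closed_list H x = Some e \<Longrightarrow> walk_len (source I) n x \<Longrightarrow> gval e \<le> real n"
  unfolding astar_inv_def by blast

lemma astar_inv_closed_succ:
  assumes "astar_inv H" "closed_list H x = Some e" "(x, w) \<in> arcs_rel" "w \<notin> dom (closed_list H)"
  obtains e' where "open_list H w = Some e'" "gval e' \<le> gval e + 1"
  using assms unfolding astar_inv_def by blast

lemma astar_inv_source:
  assumes "astar_inv H" "source I \<notin> dom (closed_list H)"
  obtains e where "open_list H (source I) = Some e" "gval e \<le> 0"
  using assms unfolding astar_inv_def by blast

section \<open>Optimality of selected states and preservation of the invariant\<close>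

lemma astar_inv_init: "astar_inv (init_config I)"
  unfolding astar_inv_def init_config_def
  by (auto intro!: exI[of _ "0::nat"])

text \<open>Induction along the walk. If the predecessor \<open>y\<close> is closed, its optimal
  g-value and the arc clause make \<open>x\<close> itself the witness. Otherwise the shorter walk
  supplies one, since by consistency length plus heuristic value does not decrease along the
  arc.\<close>

lemma open_below_walk:
  assumes "astar_inv H" and "walk_len (source I) n x" and "x \<notin> dom (closed_list H)"
  shows "\<exists>u \<in> dom (open_list H). fval I H u \<le> real n + heur I x"
  using assms(2,3)
proof (induction n arbitrary: x)
  case 0
  then obtain e where "open_list H (source I) = Some e" "gval e \<le> 0"
    using astar_inv_source[OF assms(1)] by auto
  with 0 show ?case by (intro bexI[of _ "source I"]) (auto simp: fval_def)
next
  case (Suc n)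
  then obtain y where y: "walk_len (source I) n y" "(y, x) \<in> arcs_rel" by (auto simp: walk_len_Suc)
  show ?case
  proof (cases "y \<in> dom (closed_list H)")
    case True
    then obtain e where e: "closed_list H y = Some e" by auto
    obtain e' where "open_list H x = Some e'" "gval e' \<le> gval e + 1"
      using astar_inv_closed_succ[OF assms(1) e y(2) Suc.prems(2)] .
    moreover have "gval e \<le> real n"
      using astar_inv_closed_le[OF assms(1) e y(1)] .
    ultimately show ?thesis by (intro bexI[of _ x]) (auto simp: fval_def)
  next
    case False
    with Suc.IH[OF y(1)] obtain u where "u \<in> dom (open_list H)" "fval I H u \<le> real n + heur I y"
      by blast
    with heur_arc[OF y(2)] show ?thesis by (intro bexI[of _ u]) auto
  qed
qed

text \<open>A shorter walk to \<open>v\<close> would, by \<open>open_below_walk\<close>, leave an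
  open state with smaller f-value than \<open>v\<close>.\<close>

lemma open_min_optimal:
  assumes "astar_inv H" and "v \<in> open_min I H" and "walk_len (source I) n v"
  shows "gval (the (open_list H v)) \<le> real n"
proof -
  have "v \<notin> dom (closed_list H)"
    using assms(1,2) by (auto simp: open_min_def dest: astar_inv_disjoint)
  with open_below_walk[OF assms(1,3)] obtain u
    where "u \<in> dom (open_list H)" "fval I H u \<le> real n + heur I v" by blast
  moreover from this have "fval I H v \<le> fval I H u"
    using assms(2) unfolding open_min_def by blast
  ultimately have "fval I H v \<le> real n + heur I v"
    by linarith
  then show ?thesis by (simp add: fval_def)
qed

lemma open_vert: "astar_inv H \<Longrightarrow> v \<in> dom (open_list H) \<Longrightarrow> v \<in> pverts (graph I)"
  by (auto elim: astar_inv_open dest: walk_len_verts)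

lemma astar_inv_expand:
  assumes inv: "astar_inv H" and v: "v \<in> open_min I H" and ng: "v \<notin> goals I"
  shows "astar_inv (expand I v H)"
proof -
  let ?H' = "expand I v H"
  obtain e where e: "open_list H v = Some e"
    using v by (auto simp: open_min_def)
  have vV: "v \<in> pverts (graph I)" using open_vert[OF inv] e by blast
  obtain n where n: "gval e = real n" "walk_len (source I) n v"
    using astar_inv_open[OF inv e] .
  have cl: "closed_list ?H' = (closed_list H)(v \<mapsto> e)" by (simp add: e)
  have disj: "dom (open_list ?H') \<inter> dom (closed_list ?H') = {}"
    using open_list_expandD[of I v H] astar_inv_disjoint[OF inv] by (fastforce simp: cl)
  have op: "\<exists>n. gval e' = real n \<and> walk_len (source I) n x" if x: "open_list ?H' x = Some e'" for x e'
  proof -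
    consider (old) e0 where "open_list H x = Some e0" "gval e0 = gval e'"
      | (new) "(v, x) \<in> arcs_rel" "gval e' = gval e + 1"
      using open_list_expandD[OF x] e unit_cost set_succs[OF vV] by auto
    then show ?thesis
    proof cases
      case old
      then show ?thesis using astar_inv_open[OF inv old(1)] by metis
    next
      case new
      then show ?thesis using n by (intro exI[of _ "Suc n"]) (auto simp: walk_len_Suc)
    qed
  qed
  \<comment> \<open>Arcs out of \<open>v\<close> are relaxed by its expansion; for states closed
    earlier the bound persists because g-values in OPEN never increase.\<close>
  have succ: "w \<in> dom (closed_list ?H') \<or> (\<exists>e'. open_list ?H' w = Some e' \<and> gval e' \<le> gval ex + 1)"
    if x: "closed_list ?H' x = Some ex" and xw: "(x, w) \<in> arcs_rel" for x ex w
  proof (cases "w \<in> dom (closed_list ?H')")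
    case False
    then have w: "w \<noteq> v" "w \<notin> dom (closed_list H)" by (auto simp: cl)
    show ?thesis
    proof (cases "x = v")
      case True
      then show ?thesis
        using open_list_expand_succ[of w I v H] w xw set_succs[OF vV] unit_cost e x by (auto simp: cl)
    next
      case False
      then have "closed_list H x = Some ex" using x by (simp add: cl)
      then obtain e' where "open_list H w = Some e'" "gval e' \<le> gval ex + 1"
        using astar_inv_closed_succ[OF inv _ xw w(2)] by blast
      then show ?thesis using open_list_expand_mono[of H w e' v I] w(1) by fastforce
    qed
  qed simp
  \<comment> \<open>Only \<open>v\<close> is new in CLOSED, and its membership in
    \<open>open_min\<close> makes its g-value optimal.\<close>
  have clo: "x \<notin> goals I \<and> (\<exists>n. gval ex = real n \<and> walk_len (source I) n x) \<and>
      (\<forall>n. walk_len (source I) n x \<longrightarrow> gval ex \<le> real n)"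
    if x: "closed_list ?H' x = Some ex" for x ex
  proof (cases "x = v")
    case True
    then show ?thesis using x ng open_min_optimal[OF inv v] e n by (auto simp: cl)
  next
    case False
    then have "closed_list H x = Some ex" using x by (simp add: cl)
    then show ?thesis using inv unfolding astar_inv_def by blast
  qed
  have src: "source I \<in> dom (closed_list ?H') \<or> (\<exists>e. open_list ?H' (source I) = Some e \<and> gval e \<le> 0)"
  proof (cases "source I \<in> dom (closed_list ?H')")
    case False
    then have s: "source I \<noteq> v" "source I \<notin> dom (closed_list H)" by (auto simp: cl)
    obtain e0 where "open_list H (source I) = Some e0" "gval e0 \<le> 0"
      using astar_inv_source[OF inv s(2)] .
    then show ?thesis using open_list_expand_mono[of H "source I" e0 v I] s(1) by fastforce
  qed simp
  show ?thesis
    unfolding astar_inv_def using disj op succ clo src by blast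
qed

lemma astar_inv_history: "history I hs \<Longrightarrow> astar_inv (last hs)"
proof (induction rule: history.induct)
  case init
  then show ?case by (simp add: astar_inv_init)
next
  case (step hs v)
  then have "v \<notin> goals I" by (auto simp: terminated_def)
  with step show ?case by (simp add: astar_inv_expand)
qed

text \<open>Induction on the remaining length. Length 0 is impossible, as a goal is never closed. An
  open next state is the witness: admissibility bounds its heuristic value by its remaining length,
  one less than that of \<open>y\<close>.\<close>

lemma closed_goal_path:
  assumes inv: "astar_inv H" and t: "t \<in> goals I"
  shows "closed_list H y = Some e \<Longrightarrow> walk_len y n t \<Longrightarrow>
    \<exists>x \<in> dom (open_list H). fval I H x \<le> gval e + real n \<and> heur I x \<le> real n - 1"
proof (induction n arbitrary: y e)
  case 0
  then show ?case using astar_inv_closed_goal[OF inv] t by auto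
next
  case (Suc n)
  then obtain w where w: "(y, w) \<in> arcs_rel" "walk_len w n t" by (auto simp: walk_len_Suc2)
  have hw: "heur I w \<le> real n" using admissible[OF w(2) t] .
  show ?case
  proof (cases "w \<in> dom (closed_list H)")
    case True
    then obtain e' where e': "closed_list H w = Some e'" by auto
    obtain x where x: "x \<in> dom (open_list H)" "fval I H x \<le> gval e' + real n" "heur I x \<le> real n - 1"
      using Suc.IH[OF e' w(2)] by blast
    \<comment> \<open>The state \<open>w\<close> may have been closed through another parent, but
      its optimal g-value is at most that of the walk through \<open>y\<close>. Hence g-value plus
      remaining length does not grow.\<close>
    obtain l where l: "gval e = real l" "walk_len (source I) l y"
      using astar_inv_closed[OF inv Suc.prems(1)] .
    then have "walk_len (source I) (Suc l) w" using w(1) by (auto simp: walk_len_Suc)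
    then have "gval e' \<le> gval e + 1"
      using astar_inv_closed_le[OF inv e', of "Suc l"] l(1) by simp
    with x show ?thesis by (intro bexI[of _ x]) auto
  next
    case False
    obtain e' where "open_list H w = Some e'" "gval e' \<le> gval e + 1"
      using astar_inv_closed_succ[OF inv Suc.prems(1) w(1) False] .
    then show ?thesis using hw by (intro bexI[of _ w]) (auto simp: fval_def)
  qed
qed

lemma Cstar_eq:
  "Cstar I = (INF n \<in> goal_lens (source I). ereal (real n))"
  unfolding Cstar_def by (rule hstar_eq[OF source_vert])

end


section \<open>The plateau of minimum f-value C*\<close>

locale solvable_unit_cost_search = unit_cost_search +
  assumes solvable: "solvable I"
begin

text \<open>\<open>Cstar I\<close> as a natural number; solvability makes the set nonempty, so
  \<open>LEAST\<close> picks its minimum.\<close>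

definition C :: nat where "C = (LEAST n. n \<in> goal_lens (source I))"

lemma Cstar_real: "Cstar I = ereal (real C)"
  and C_attained: "\<exists>t \<in> goals I. walk_len (source I) C t"
proof -
  have "(INF n \<in> goal_lens (source I). ereal (real n)) < \<infinity>"
    using solvable unfolding solvable_def Cstar_eq .
  then obtain n where n: "n \<in> goal_lens (source I)"
    "\<And>m. m \<in> goal_lens (source I) \<Longrightarrow> n \<le> m" "Cstar I = ereal (real n)"
    unfolding Cstar_eq using INF_nat_attained by blast
  then have "C = n"
    unfolding C_def by (intro Least_equality) auto
  with n show "Cstar I = ereal (real C)" "\<exists>t \<in> goals I. walk_len (source I) C t"
    by (auto simp: goal_lens_def)
qed

text \<open>The lower bound is what has to be carried through expansions; the matching upper bound
  is derived in \<open>plateau_open_min\<close>.\<close>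

definition plateau :: "'a config \<Rightarrow> bool" where
  "plateau H \<longleftrightarrow> astar_inv H \<and> (\<forall>v \<in> dom (open_list H). real C \<le> fval I H v)"

text \<open>An optimal path ends in a goal, which is not closed and has heuristic value 0, so
  \<open>open_below_walk\<close> supplies an open state with f-value at most
  \<open>C\<close>.\<close>

lemma plateau_open_min:
  assumes "plateau H"
  shows "open_min I H = {v \<in> dom (open_list H). fval I H v \<le> real C}"
    and "open_min I H \<noteq> {}"
proof -
  have inv: "astar_inv H" and low: "\<And>v. v \<in> dom (open_list H) \<Longrightarrow> real C \<le> fval I H v"
    using assms by (auto simp: plateau_def)
  obtain t where t: "t \<in> goals I" "walk_len (source I) C t" using C_attained by blast
  have "t \<notin> dom (closed_list H)" using astar_inv_closed_goal[OF inv] t(1) by blast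
  then obtain u where u: "u \<in> dom (open_list H)" "fval I H u \<le> real C"
    using open_below_walk[OF inv t(2)] heur_goal t(1) by auto
  show *: "open_min I H = {v \<in> dom (open_list H). fval I H v \<le> real C}"
    unfolding open_min_def using u low by (blast intro: order_trans)
  show "open_min I H \<noteq> {}" using u unfolding * by blast
qed

lemma plateau_fval: "plateau H \<Longrightarrow> v \<in> open_min I H \<Longrightarrow> fval I H v = real C"
  unfolding plateau_open_min(1) by (auto simp: plateau_def intro: antisym)

lemma plateau_vert: "plateau H \<Longrightarrow> v \<in> open_min I H \<Longrightarrow> v \<in> pverts (graph I)"
  using open_vert by (auto simp: plateau_def open_min_def)

text \<open>Expresses termination through heuristic values, the quantity tracked by the counting.
  OPEN is nonempty on the plateau, which rules out the other way to terminate.\<close>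

lemma plateau_terminated:
  assumes "plateau H"
  shows "terminated I H \<longleftrightarrow> (\<exists>v \<in> open_min I H. heur I v \<le> 0)"
proof -
  have "dom (open_list H) \<noteq> {}" using plateau_open_min(2)[OF assms] by (auto simp: open_min_def)
  moreover have "v \<in> goals I \<longleftrightarrow> heur I v \<le> 0" if "v \<in> open_min I H" for v
    using plateau_vert[OF assms that] heur_goal heur_pos by force
  ultimately show ?thesis unfolding terminated_def by blast
qed

section \<open>Effect of an expansion on the plateau\<close>

lemma expand_fval:
  assumes "plateau H" and v: "v \<in> open_min I H" and x: "x \<in> dom (open_list (expand I v H))"
  shows "(x \<in> dom (open_list H) \<and> fval I (expand I v H) x = fval I H x) \<or>
    ((v, x) \<in> arcs_rel \<and> fval I (expand I v H) x = real C + 1 + heur I x - heur I v)"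
proof -
  obtain e where e: "open_list (expand I v H) x = Some e" using x by auto
  note vV = plateau_vert[OF assms(1) v]
  have "gval (the (open_list H v)) = real C - heur I v"
    using plateau_fval[OF assms(1) v] by (simp add: fval_def)
  with open_list_expandD[OF e] set_succs[OF vV] unit_cost e
  show ?thesis by (auto simp: fval_def)
qed

lemma plateau_expand:
  assumes pl: "plateau H" and nt: "\<not> terminated I H" and v: "v \<in> open_min I H"
  shows "plateau (expand I v H)"
proof -
  have "v \<notin> goals I" using nt v by (auto simp: terminated_def)
  then have "astar_inv (expand I v H)" using pl v astar_inv_expand by (auto simp: plateau_def)
  moreover have "real C \<le> fval I (expand I v H) x" if "x \<in> dom (open_list (expand I v H))" for x
    using expand_fval[OF pl v that] heur_arc[of v x] pl by (auto simp: plateau_def)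
  ultimately show ?thesis by (simp add: plateau_def)
qed

text \<open>A state with unchanged f-value was already in \<open>open_min\<close>; a value set along
  the arc from \<open>v\<close> equals \<open>C\<close> only if
  \<open>heur I x = heur I v - 1\<close>. Here \<open>v\<close> is any selectable state, so every
  tie-breaker is covered.\<close>

lemma open_min_expand_heur:
  assumes pl: "plateau H" and nt: "\<not> terminated I H" and v: "v \<in> open_min I H"
    and low: "\<forall>x \<in> open_min I H. r \<le> heur I x" and x: "x \<in> open_min I (expand I v H)"
  shows "r - 1 \<le> heur I x"
proof -
  have x': "x \<in> dom (open_list (expand I v H))" "fval I (expand I v H) x = real C"
    using x plateau_fval[OF plateau_expand[OF pl nt v] x] by (auto simp: open_min_def)
  have "x \<in> open_min I H \<or> heur I x = heur I v - 1"
    using expand_fval[OF pl v x'(1)] x'(2) unfolding plateau_open_min(1)[OF pl] by auto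
  then show ?thesis using low v by auto
qed

lemma plateau_fmin:
  assumes hist: "history I hs" and fmin: "fmin I (last hs) = Cstar I"
  shows "plateau (last hs)"
proof -
  have "real C \<le> fval I (last hs) v" if "v \<in> dom (open_list (last hs))" for v
  proof -
    have "fmin I (last hs) \<le> ereal (fval I (last hs) v)"
      unfolding fmin_def using that by (rule INF_lower)
    then show ?thesis by (simp add: fmin Cstar_real)
  qed
  then show ?thesis using astar_inv_history[OF hist] by (simp add: plateau_def)
qed

section \<open>States of least heuristic value\<close>

lemma min_h_open_min:
  assumes hist: "history I hs" and pl: "plateau (last hs)"
  shows "\<exists>v \<in> open_min I (last hs). heur I v = min_h I (last hs)"
    and "\<forall>v \<in> open_min I (last hs). min_h I (last hs) \<le> heur I v"
proof -
  have fin: "finite (open_min I (last hs))"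
    using finite_open_history[OF hist] by (simp add: open_min_def)
  have "min_h I (last hs) \<in> heur I ` open_min I (last hs)"
    unfolding min_h_def using fin plateau_open_min(2)[OF pl] by (intro Min_in) auto
  then show "\<exists>v \<in> open_min I (last hs). heur I v = min_h I (last hs)" by auto
  show "\<forall>v \<in> open_min I (last hs). min_h I (last hs) \<le> heur I v"
    unfolding min_h_def using fin by auto
qed

lemma low_h_select:
  assumes \<tau>: "tie_rule \<tau>" and hist: "history I hs" and pl: "plateau (last hs)"
  shows "low_h I \<tau> \<omega> hs \<in> {v \<in> open_min I (last hs). heur I v = min_h I (last hs)}"
proof -
  have "{v \<in> open_min I (last hs). heur I v = min_h I (last hs)} \<noteq> {}"
    using min_h_open_min(1)[OF hist pl] by auto
  then show ?thesis
    unfolding low_h_def by (rule \<tau>[unfolded tie_rule_def, rule_format])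
qed

text \<open>Heuristic values on \<open>open_min\<close> are integral because \<open>C\<close> and
  the g-values are. The difference is taken in the reals to avoid truncation.\<close>

lemma plateau_gval:
  assumes pl: "plateau H" and v: "v \<in> open_min I H"
  obtains n where "gval (the (open_list H v)) = real n" "walk_len (source I) n v"
    "heur I v = real C - real n"
proof -
  obtain e where e: "open_list H v = Some e" using v by (auto simp: open_min_def)
  obtain n where n: "gval e = real n" "walk_len (source I) n v"
    using astar_inv_open[OF _ e] pl by (auto simp: plateau_def)
  with e plateau_fval[OF pl v] that[of n] show thesis by (simp add: fval_def)
qed

text \<open>Connects the run with the layers, which are defined by optimal values: the g-value of a
  selectable state is already optimal.\<close>

lemma plateau_S_eq:
  assumes pl: "plateau H" and v: "v \<in> open_min I H" and ng: "v \<notin> goals I"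
  shows "v \<in> S_eq I"
proof -
  obtain n where n: "gval (the (open_list H v)) = real n" "walk_len (source I) n v"
    "heur I v = real C - real n"
    using plateau_gval[OF pl v] .
  have "n \<le> m" if "walk_len (source I) m v" for m
    using open_min_optimal[OF _ v that] n(1) pl by (simp add: plateau_def)
  then have "gstar I v = ereal (real n)"
    unfolding gstar_eq using n(2) by (intro antisym INF_lower INF_greatest) auto
  then have "fstar I v = Cstar I" by (simp add: fstar_def n(3) Cstar_real)
  moreover have "source I \<rightarrow>\<^sup>*\<^bsub>with_proj (graph I)\<^esub> v"
  proof -
    interpret pair_wf_digraph "graph I" by (rule wf_graph)
    show ?thesis
      using relpow_imp_awalk[OF wf_graph source_vert n(2)[unfolded walk_len_def]]
      by (auto simp: reachable_awalk)
  qed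
  ultimately show ?thesis using ng by (simp add: S_eq_def)
qed

lemma expand_low_h:
  assumes pl: "plateau H" and nt: "\<not> terminated I H" and v: "v \<in> open_min I H"
    and perfect: "\<forall>v \<in> layers_upto I k. ereal (heur I v) = hstar I v"
    and hv: "heur I v = real (Suc j)" and jk: "Suc j \<le> k"
  shows "\<exists>x \<in> open_min I (expand I v H). heur I x \<le> real j"
proof -
  note pl' = plateau_expand[OF pl nt v]
  have "v \<notin> goals I" using nt v by (auto simp: terminated_def)
  then have "v \<in> layer I (Suc j)" using plateau_S_eq[OF pl v] hv by (simp add: layer_def)
  then have "v \<in> layers_upto I k" unfolding layers_upto_def using jk by (intro UN_I[of "Suc j"]) auto
  then have "hstar I v = ereal (real (Suc j))" using perfect hv by metis
  then have h: "(INF n \<in> goal_lens v. ereal (real n)) = ereal (real (Suc j))"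
    unfolding hstar_eq[OF plateau_vert[OF pl v]] .
  then have "(INF n \<in> goal_lens v. ereal (real n)) < \<infinity>" by simp
  then obtain n where "n \<in> goal_lens v" "(INF n \<in> goal_lens v. ereal (real n)) = ereal (real n)"
    using INF_nat_attained by blast
  \<comment> \<open>The infimum is attained, so perfectness yields a goal walk of length exactly
    \<open>Suc j\<close>.\<close>
  with h have "Suc j \<in> goal_lens v" by (metis ereal.inject of_nat_eq_iff)
  then obtain t where t: "t \<in> goals I" "walk_len v (Suc j) t" by (auto simp: goal_lens_def)
  \<comment> \<open>The path argument is applied after the expansion, when \<open>v\<close> itself
    is closed. The f-value \<open>C\<close> of \<open>v\<close> then bounds that of the state found,
    which puts it in \<open>open_min\<close>.\<close>
  have cl: "closed_list (expand I v H) v = Some (the (open_list H v))" by simp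
  have gv: "gval (the (open_list H v)) + real (Suc j) = real C"
    using plateau_fval[OF pl v] hv by (simp add: fval_def)
  have "astar_inv (expand I v H)" using pl' by (simp add: plateau_def)
  from closed_goal_path[OF this t(1) cl t(2)] obtain x
    where "x \<in> dom (open_list (expand I v H))" "fval I (expand I v H) x \<le> real C" "heur I x \<le> real j"
    unfolding gv by auto
  then show ?thesis unfolding plateau_open_min(1)[OF pl'] by blast
qed


section \<open>Counting expansions\<close>

text \<open>History and plateau are carried along because \<open>tie_breaker\<close> constrains
  choices on histories and the one-step bound needs the plateau.\<close>

lemma continuation_lower:
  assumes \<sigma>: "tie_breaker I \<sigma>" and hist: "history I hs" and pl: "plateau (last hs)"
    and low: "\<forall>x \<in> open_min I (last hs). real m \<le> heur I x" and "i \<le> m"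
  shows "history I (continuation I \<sigma> \<omega> hs i) \<and> plateau (last (continuation I \<sigma> \<omega> hs i)) \<and>
    (\<forall>x \<in> open_min I (last (continuation I \<sigma> \<omega> hs i)). real (m - i) \<le> heur I x)"
  using \<open>i \<le> m\<close>
proof (induction i)
  case 0
  then show ?case using hist pl low by simp
next
  case (Suc i)
  define hs' where "hs' = continuation I \<sigma> \<omega> hs i"
  have IH: "history I hs'" "plateau (last hs')" "\<forall>x \<in> open_min I (last hs'). real (m - i) \<le> heur I x"
    using Suc by (simp_all add: hs'_def)
  \<comment> \<open>Since \<open>Suc i \<le> m\<close>, the bound \<open>m - i\<close> is positive,
    so \<open>open_min\<close> contains no goal.\<close>
  have nt: "\<not> terminated I (last hs')"
    using IH(3) Suc.prems unfolding plateau_terminated[OF IH(2)] by force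
  then have v: "\<sigma> \<omega> hs' \<in> open_min I (last hs')"
    using \<sigma> IH(1) by (auto simp: tie_breaker_def)
  have cont: "continuation I \<sigma> \<omega> hs (Suc i) = hs' @ [expand I (\<sigma> \<omega> hs') (last hs')]"
    using nt by (simp add: hs'_def Let_def)
  have "history I (hs' @ [expand I (\<sigma> \<omega> hs') (last hs')])"
    by (rule history.step[OF IH(1) nt v])
  moreover have "plateau (expand I (\<sigma> \<omega> hs') (last hs'))"
    by (rule plateau_expand[OF IH(2) nt v])
  moreover have "real (m - Suc i) \<le> heur I x"
    if "x \<in> open_min I (expand I (\<sigma> \<omega> hs') (last hs'))" for x
    using open_min_expand_heur[OF IH(2) nt v IH(3) that] Suc.prems by (simp add: of_nat_diff)
  ultimately show ?case unfolding cont by simp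
qed

lemma not_terminated_before:
  assumes "tie_breaker I \<sigma>" "history I hs" "plateau (last hs)"
    and "\<forall>x \<in> open_min I (last hs). real m \<le> heur I x" and "i < m"
  shows "\<not> terminated I (last (continuation I \<sigma> \<omega> hs i))"
proof -
  have "plateau (last (continuation I \<sigma> \<omega> hs i))"
    "\<forall>x \<in> open_min I (last (continuation I \<sigma> \<omega> hs i)). real (m - i) \<le> heur I x"
    using continuation_lower[OF assms(1-4)] assms(5) by simp_all
  then show ?thesis using assms(5) by (force simp: plateau_terminated)
qed

lemma num_expansions_ge:
  assumes "tie_breaker I \<sigma>" "history I hs" "plateau (last hs)"
    and "\<forall>x \<in> open_min I (last hs). real m \<le> heur I x"
  shows "enat m \<le> num_expansions I \<sigma> \<omega> hs"
proof -
  have "m \<le> i" if "terminated I (last (continuation I \<sigma> \<omega> hs i))" for i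
    using not_terminated_before[OF assms, of i \<omega>] that by (meson not_less)
  \<comment> \<open>A continuation that never terminates counts as infinity, where the bound is
    trivial.\<close>
  then show ?thesis
    unfolding num_expansions_def by (auto intro: LeastI2)
qed

text \<open>After \<open>i\<close> steps the least heuristic value is exactly \<open>m - i\<close>:
  at least by \<open>continuation_lower\<close>, at most by induction through
  \<open>expand_low_h\<close>. After \<open>m\<close> steps it is 0, which means
  termination.\<close>

lemma num_expansions_low_h_le:
  assumes \<tau>: "tie_rule \<tau>" and hist: "history I hs" and pl: "plateau (last hs)"
    and perfect: "\<forall>v \<in> layers_upto I k. ereal (heur I v) = hstar I v" and "m \<le> k"
    and min_h: "min_h I (last hs) = real m"
  shows "num_expansions I (low_h I \<tau>) \<omega> hs \<le> enat m"
proof -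
  let ?K = "continuation I (low_h I \<tau>) \<omega> hs"
  have low: "\<forall>x \<in> open_min I (last hs). real m \<le> heur I x"
    using min_h_open_min(2)[OF hist pl] by (simp add: min_h)
  note tb = tie_breaker_low_h[OF \<tau>]
  note lower = continuation_lower[OF tb hist pl low]
  have "i \<le> m \<Longrightarrow> \<exists>x \<in> open_min I (last (?K i)). heur I x \<le> real (m - i)" for i
  proof (induction i)
    case 0
    then show ?case using min_h_open_min(1)[OF hist pl] by (force simp: min_h)
  next
    case (Suc i)
    have hi: "history I (?K i)" and pi: "plateau (last (?K i))"
      and li: "\<forall>x \<in> open_min I (last (?K i)). real (m - i) \<le> heur I x"
      using lower[of i \<omega>] Suc.prems by simp_all
    have nt: "\<not> terminated I (last (?K i))"
      by (rule not_terminated_before[OF tb hist pl low]) (use Suc.prems in simp)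
    note low_h_select[OF \<tau> hi pi, of \<omega>]
    then have v: "low_h I \<tau> \<omega> (?K i) \<in> open_min I (last (?K i))"
      and hv: "heur I (low_h I \<tau> \<omega> (?K i)) = min_h I (last (?K i))" by auto
    have "min_h I (last (?K i)) = real (m - i)"
    proof (rule antisym)
      show "min_h I (last (?K i)) \<le> real (m - i)"
        using Suc min_h_open_min(2)[OF hi pi] by (meson Suc_leD order_trans)
      show "real (m - i) \<le> min_h I (last (?K i))"
        using li v hv by auto
    qed
    \<comment> \<open>Puts the value in the form required by \<open>expand_low_h\<close>, with
      \<open>j = m - Suc i\<close>; the layer index \<open>m - i\<close> stays at most
      \<open>k\<close>.\<close>
    moreover have "m - i = Suc (m - Suc i)" using Suc.prems by simp
    ultimately have "heur I (low_h I \<tau> \<omega> (?K i)) = real (Suc (m - Suc i))" using hv by metis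
    from expand_low_h[OF pi nt v perfect this] show ?case
      using nt Suc.prems \<open>m \<le> k\<close> by (simp add: Let_def)
  qed
  from this[of m] have "terminated I (last (?K m))"
    using lower[of m \<omega>] by (simp add: plateau_terminated)
  then show ?thesis
    unfolding num_expansions_def by (auto intro: Least_le)
qed

lemma min_h_nat:
  assumes hist: "history I hs" and pl: "plateau (last hs)" and "open_min I (last hs) \<inter> goals I = {}"
  obtains m where "min_h I (last hs) = real m"
proof -
  obtain v where v: "v \<in> open_min I (last hs)" "heur I v = min_h I (last hs)"
    using min_h_open_min(1)[OF hist pl] by blast
  obtain n where n: "heur I v = real C - real n"
    using plateau_gval[OF pl v(1)] by blast
  \<comment> \<open>Positivity forces \<open>n < C\<close>, so the real difference is the natural
    number \<open>C - n\<close>.\<close>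
  have "0 < heur I v" using v(1) assms(3) heur_pos plateau_vert[OF pl v(1)] by blast
  with n v(2) have "min_h I (last hs) = real (C - n)" by (simp add: of_nat_diff)
  with that show thesis .
qed

end

theorem theorem2:
  fixes I :: "'v search_instance" and k :: nat and H :: "'v config"
  assumes "search_instance I"
    and "solvable I"
    and "\<forall>a \<in> parcs (graph I). cost I a = 1"
    and "consistent I"
    and "\<forall>v \<in> goals I. heur I v = 0"
    and "\<forall>v \<in> pverts (graph I) - goals I. 0 < heur I v"
    and "1 \<le> k"
    and "\<forall>v \<in> layers_upto I k. ereal (heur I v) = hstar I v"
    and "reachable_config I H"
    and "fmin I H = Cstar I"
    and "open_min I H \<inter> goals I = {}"
    and "min_h I H \<le> real k"
  shows "(\<forall>(\<tau> :: ('r, 'v) tie_rule) \<omega> hs.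
            tie_rule \<tau> \<and> history I hs \<and> last hs = H \<longrightarrow>
            ereal_of_enat (num_expansions I (low_h I \<tau>) \<omega> hs) = ereal (min_h I H))
       \<and> (\<forall>(\<sigma> :: ('r, 'v) strategy) \<omega> hs.
            tie_breaker I \<sigma> \<and> history I hs \<and> last hs = H \<longrightarrow>
            ereal (min_h I H) \<le> ereal_of_enat (num_expansions I \<sigma> \<omega> hs))"
proof -
  interpret solvable_unit_cost_search I
    using assms(1-6) by unfold_locales
  \<comment> \<open>Strategies may depend on the past, so the bounds are proved for every history
    ending in \<open>H\<close>.\<close>
  have main: "(\<forall>\<sigma> :: ('r, 'v) strategy. tie_breaker I \<sigma> \<longrightarrow>
      (\<forall>\<omega>. enat m \<le> num_expansions I \<sigma> \<omega> hs)) \<and>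
    (\<forall>\<tau> :: ('r, 'v) tie_rule. tie_rule \<tau> \<longrightarrow>
      (\<forall>\<omega>. num_expansions I (low_h I \<tau>) \<omega> hs = enat m))"
    if hist: "history I hs" and last: "last hs = H" and m: "min_h I H = real m" for hs m
  proof -
    have pl: "plateau (last hs)" using plateau_fmin[OF hist] assms(10) last by simp
    have low: "\<forall>x \<in> open_min I (last hs). real m \<le> heur I x"
      using min_h_open_min(2)[OF hist pl] by (simp add: m last)
    have "m \<le> k" using assms(12) m by simp
    have "num_expansions I (low_h I \<tau>) \<omega> hs = enat m" if "tie_rule \<tau>" for \<tau> :: "('r, 'v) tie_rule" and \<omega>
      using num_expansions_ge[OF tie_breaker_low_h[OF that] hist pl low]
        num_expansions_low_h_le[OF that hist pl assms(8) \<open>m \<le> k\<close>] m last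
      by (simp add: antisym)
    moreover have "enat m \<le> num_expansions I \<sigma> \<omega> hs" if "tie_breaker I \<sigma>" for \<sigma> :: "('r, 'v) strategy" and \<omega>
      by (rule num_expansions_ge[OF that hist pl low])
    ultimately show ?thesis by blast
  qed
  have "\<exists>m. min_h I H = real m" if "history I hs" "last hs = H" for hs
    using min_h_nat[OF that(1)] plateau_fmin[OF that(1)] assms(10,11) that(2) by metis
  \<comment> \<open>\<open>min_h I H\<close> depends on \<open>H\<close> alone, so the number found
    from one history leading to \<open>H\<close> serves all of them.\<close>
  then obtain m where m: "min_h I H = real m"
    using assms(9) unfolding reachable_config_def by blast
  show ?thesis
  proof (intro conjI allI impI; elim conjE)
    fix \<tau> :: "('r, 'v) tie_rule" and \<omega> hs
    assume "tie_rule \<tau>" "history I hs" "last hs = H"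
    then have "num_expansions I (low_h I \<tau>) \<omega> hs = enat m" using main m by blast
    then show "ereal_of_enat (num_expansions I (low_h I \<tau>) \<omega> hs) = ereal (min_h I H)"
      by (simp add: m)
  next
    fix \<sigma> :: "('r, 'v) strategy" and \<omega> hs
    assume "tie_breaker I \<sigma>" "history I hs" "last hs = H"
    then have "enat m \<le> num_expansions I \<sigma> \<omega> hs" using main m by blast
    then have "ereal_of_enat (enat m) \<le> ereal_of_enat (num_expansions I \<sigma> \<omega> hs)"
      by (simp only: ereal_of_enat_le_iff)
    then show "ereal (min_h I H) \<le> ereal_of_enat (num_expansions I \<sigma> \<omega> hs)"
      by (simp add: m)
  qed
qed

end
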